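(* Let $X$ be an Hadamard space with linear dual space $X^{\lozenge}$ and let $M\subseteq X\times X^{\lozenge}$. Then $M$ is monotone if and only if there exists a maximal monotone set $\widetilde{M}\subseteq X\times X^{\lozenge}$ such that $\widetilde{M}\subseteq M^{\mu}$.
   Context: An Hadamard space is a complete $\mathrm{CAT}(0)$ space $(X,d)$. For $a,b\in X$ write $\overrightarrow{ab}$ for the ordered pair $(a,b)\in X^2$. The quasilinearization is $\langle\overrightarrow{ab},\overrightarrow{cd}\rangle:=\frac12\big(d(a,d)^2+d(b,c)^2-d(a,c)^2-d(b,d)^2\big)$. The dual space $X^*$ is the set of equivalence classes $[t\overrightarrow{ab}]$ of triples $(t,a,b)\in\mathbb{R}\times X^2$, where $(t,a,b)\sim(s,c,d)$ iff $t\langle\overrightarrow{ab},\overrightarrow{xy}\rangle=s\langle\overrightarrow{cd},\overrightarrow{xy}\rangle$ for all $x,y\in X$; it acts on $X^2$ by $\langle[t\overrightarrow{ab}],\overrightarrow{xy}\rangle=t\langle\overrightarrow{ab},\overrightarrow{xy}\rangle$. The linear dual space $X^{\lozenge}=\mathrm{span}\,X^*$ is the vector space of finite linear combinations $\sum_i\alpha_ix_i^*$ ($\alpha_i\in\mathbb{R}$, $x_i^*\in X^*$), identified with the functions they define on $X^2$ by $\langle\sum_i\alpha_ix_i^*,\overrightarrow{xy}\rangle=\sum_i\alpha_i\langle x_i^*,\overrightarrow{xy}\rangle$. Elements $(x,x^{\lozenge}),(y,y^{\lozenge})\in X\times X^{\lozenge}$ are monotonically related, written $(x,x^{\lozenge})\,\mu\,(y,y^{\lozenge})$,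 if $\langle x^{\lozenge}-y^{\lozenge},\overrightarrow{yx}\rangle\ge 0$. A set $M\subseteq X\times X^{\lozenge}$ is monotone if any two of its elements are monotonically related; a monotone set is maximal if no monotone set properly contains it. The monotone polar of $M\subseteq X\times X^{\lozenge}$ is $M^{\mu}:=\{(x,x^{\lozenge})\in X\times X^{\lozenge}: (x,x^{\lozenge})\,\mu\,(y,y^{\lozenge})\ \text{for all } (y,y^{\lozenge})\in M\}$. *)

theory Defs
  imports "HOL-Analysis.Analysis"
begin

definition geodesic_segment :: "'a::metric_space set \<Rightarrow> 'a \<Rightarrow> 'a \<Rightarrow> bool" where
  "geodesic_segment S x y \<longleftrightarrow>
     (\<exists>c :: real \<Rightarrow> 'a. c 0 = x \<and> c (dist x y) = y \<and>
        (\<forall>s\<in>{0..dist x y}. \<forall>t\<in>{0..dist x y}. dist (c s) (c t) = \<bar>s - t\<bar>) \<and>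
        S = c ` {0..dist x y})"

text \<open>
  The sides of a geodesic triangle are \<open>A\<close> from \<open>x\<close> to \<open>y\<close>, \<open>B\<close> from \<open>y\<close> to \<open>z\<close> and \<open>C\<close> from
  \<open>z\<close> to \<open>x\<close>; primed variables live in the Euclidean plane.  A point lying on several sides may
  have several comparison points, one for each of them.
\<close>

definition comparison_point ::
  "'a::metric_space set \<times> 'a set \<times> 'a set \<Rightarrow> 'a \<times> 'a \<times> 'a \<Rightarrow>
   (real^2) \<times> (real^2) \<times> (real^2) \<Rightarrow> 'a \<Rightarrow> real^2 \<Rightarrow> bool" where
  "comparison_point = (\<lambda>(A, B, C) (x, y, z) (x', y', z') p p'.
     (p \<in> A \<and> p' \<in> closed_segment x' y' \<and> dist x' p' = dist x p) \<or>
     (p \<in> B \<and> p' \<in> closed_segment y' z' \<and> dist y' p' = dist y p) \<or>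
     (p \<in> C \<and> p' \<in> closed_segment z' x' \<and> dist z' p' = dist z p))"

class cat0_space = metric_space +
  assumes geodesic_space: "\<exists>S. geodesic_segment S x y"
    and cat0_inequality:
      "geodesic_segment A x y \<Longrightarrow> geodesic_segment B y z \<Longrightarrow> geodesic_segment C z x \<Longrightarrow>
       dist x' y' = dist x y \<Longrightarrow> dist y' z' = dist y z \<Longrightarrow> dist z' x' = dist z x \<Longrightarrow>
       comparison_point (A, B, C) (x, y, z) (x', y', z') p p' \<Longrightarrow>
       comparison_point (A, B, C) (x, y, z) (x', y', z') q q' \<Longrightarrow>
       dist p q \<le> dist p' q'"

class hadamard_space = cat0_space + complete_space

definition qlin :: "'a::metric_space \<times> 'a \<Rightarrow> 'a \<times> 'a \<Rightarrow> real" where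
  "qlin = (\<lambda>(a, b) (c, d).
     ((dist a d)\<^sup>2 + (dist b c)\<^sup>2 - (dist a c)\<^sup>2 - (dist b d)\<^sup>2) / 2)"

definition dual_rel :: "real \<times> 'a::metric_space \<times> 'a \<Rightarrow> real \<times> 'a \<times> 'a \<Rightarrow> bool" where
  "dual_rel = (\<lambda>(t, ab) (s, cd). \<forall>xy. t * qlin ab xy = s * qlin cd xy)"

quotient_type (overloaded) 'a dual = "real \<times> 'a::metric_space \<times> 'a" / dual_rel
proof (rule equivpI)
  show "reflp dual_rel" by (auto simp: reflp_def dual_rel_def)
  show "symp dual_rel" by (auto simp: symp_def dual_rel_def)
  show "transp dual_rel" by (auto simp: transp_def dual_rel_def)
qed

lift_definition dual_pairing :: "'a::metric_space dual \<Rightarrow> 'a \<times> 'a \<Rightarrow> real"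
  is "\<lambda>(t, ab) xy. t * qlin ab xy"
  by (auto simp: dual_rel_def fun_eq_iff)

text \<open>
  The elements of the linear dual space are the functions on pairs of points that the finite
  linear combinations of dual elements define; differences of them are the pointwise differences
  of functions.
\<close>

definition linear_dual :: "('a::metric_space \<times> 'a \<Rightarrow> real) set" where
  "linear_dual = {f. \<exists>(n::nat) (\<alpha> :: nat \<Rightarrow> real) (\<xi> :: nat \<Rightarrow> 'a dual).
     f = (\<lambda>xy. \<Sum>i<n. \<alpha> i * dual_pairing (\<xi> i) xy)}"

definition mono_related ::
  "'a::metric_space \<times> ('a \<times> 'a \<Rightarrow> real) \<Rightarrow> 'a \<times> ('a \<times> 'a \<Rightarrow> real) \<Rightarrow> bool" where
  "mono_related = (\<lambda>(x, f) (y, g). (f - g) (y, x) \<ge> 0)"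

definition monotone_set :: "('a::metric_space \<times> ('a \<times> 'a \<Rightarrow> real)) set \<Rightarrow> bool" where
  "monotone_set M \<longleftrightarrow>
     M \<subseteq> UNIV \<times> linear_dual \<and> (\<forall>p\<in>M. \<forall>q\<in>M. mono_related p q)"

definition maximal_monotone_set :: "('a::metric_space \<times> ('a \<times> 'a \<Rightarrow> real)) set \<Rightarrow> bool" where
  "maximal_monotone_set M \<longleftrightarrow> monotone_set M \<and> \<not> (\<exists>N. monotone_set N \<and> M \<subset> N)"

definition monotone_polar ::
  "('a::metric_space \<times> ('a \<times> 'a \<Rightarrow> real)) set \<Rightarrow> ('a \<times> ('a \<times> 'a \<Rightarrow> real)) set" where
  "monotone_polar M = {p \<in> UNIV \<times> linear_dual. \<forall>q\<in>M. mono_related p q}"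

end

theory Submission imports Defs begin

text \<open>
  Monotone relatedness is reflexive and, as elements of the linear dual are antisymmetric,
  symmetric. Hence a maximal monotone set is its own polar: if it lies in the polar of \<open>M\<close>, it
  contains \<open>M\<close>. Conversely, Zorn's lemma extends a monotone \<open>M\<close> to a maximal monotone set, which
  lies in the polar of \<open>M\<close>.
\<close>

lemma qlin_swap_right: "qlin ab (y, x) = - qlin ab (x, y)"
  by (cases ab) (simp add: qlin_def field_simps)

lemma dual_pairing_swap: "dual_pairing \<xi> (y, x) = - dual_pairing \<xi> (x, y)"
proof (transfer fixing: x y)
  fix tab :: "real \<times> 'a \<times> 'a"
  show "(case tab of (t, ab) \<Rightarrow> \<lambda>xy. t * qlin ab xy) (y, x) =
      - (case tab of (t, ab) \<Rightarrow> \<lambda>xy. t * qlin ab xy) (x, y)"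
    by (cases tab) (simp add: qlin_swap_right[of _ y x])
qed

lemma linear_dual_swap:
  assumes "f \<in> linear_dual"
  shows "f (y, x) = - f (x, y)"
  using assms dual_pairing_swap[of _ y x] by (auto simp: linear_dual_def sum_negf)

lemma mono_related_refl: "mono_related p p"
  by (cases p) (simp add: mono_related_def)

text \<open>Exchanging the two elements negates the difference \<open>f - g\<close> and reverses the
  pair \<open>(y, x)\<close>; by antisymmetry the two sign changes cancel.\<close>

lemma mono_related_sym:
  assumes "p \<in> UNIV \<times> linear_dual" "q \<in> UNIV \<times> linear_dual" "mono_related p q"
  shows "mono_related q p"
proof -
  obtain x f y g where "p = (x, f)" "q = (y, g)"
    by (cases p, cases q)
  then show ?thesis
    using assms linear_dual_swap[of f y x] linear_dual_swap[of g y x]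
    by (simp add: mono_related_def)
qed

lemma monotone_set_iff_subset_polar: "monotone_set M \<longleftrightarrow> M \<subseteq> monotone_polar M"
  by (auto simp: monotone_set_def monotone_polar_def)

lemma monotone_set_insert:
  assumes "monotone_set M" "p \<in> monotone_polar M"
  shows "monotone_set (insert p M)"
  using assms mono_related_refl mono_related_sym
  unfolding monotone_set_def monotone_polar_def by blast

text \<open>Adjoining an element of the polar keeps the set monotone, so by maximality that element
  was already there.\<close>

lemma maximal_monotone_set_polar:
  assumes "maximal_monotone_set M"
  shows "monotone_polar M = M"
proof
  show "M \<subseteq> monotone_polar M"
    using assms monotone_set_iff_subset_polar by (auto simp: maximal_monotone_set_def)
  show "monotone_polar M \<subseteq> M"
  proof
    fix p assume "p \<in> monotone_polar M"
    with assms have "monotone_set (insert p M)"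
      by (simp add: maximal_monotone_set_def monotone_set_insert)
    with assms show "p \<in> M"
      unfolding maximal_monotone_set_def by blast
  qed
qed

text \<open>The Galois connection property of the polar, which rests on the symmetry of
  \<open>mono_related\<close> on \<open>UNIV \<times> linear_dual\<close>.\<close>

lemma subset_polar_sym:
  assumes "M \<subseteq> UNIV \<times> linear_dual" "N \<subseteq> monotone_polar M"
  shows "M \<subseteq> monotone_polar N"
  using assms mono_related_sym unfolding monotone_polar_def by blast

lemma monotone_polar_antimono: "M \<subseteq> N \<Longrightarrow> monotone_polar N \<subseteq> monotone_polar M"
  by (auto simp: monotone_polar_def)

lemma monotone_set_subset: "monotone_set N \<Longrightarrow> M \<subseteq> N \<Longrightarrow> monotone_set M"
  unfolding monotone_set_def by blast

text \<open>Monotonicity tests only two elements at a time, and any two elements of the union lie in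
  the larger of two members of the chain.\<close>

lemma monotone_set_Union_chain:
  assumes "subset.chain (Collect monotone_set) C"
  shows "monotone_set (\<Union>C)"
  unfolding monotone_set_def
proof (intro conjI ballI)
  show "\<Union>C \<subseteq> UNIV \<times> linear_dual"
    using assms unfolding subset.chain_def monotone_set_def by blast
next
  fix p q assume "p \<in> \<Union>C" "q \<in> \<Union>C"
  then obtain A B where AB: "A \<in> C" "B \<in> C" "p \<in> A" "q \<in> B"
    by blast
  with assms have "A \<subseteq> B \<or> B \<subseteq> A" "monotone_set A" "monotone_set B"
    by (auto simp: subset_chain_def)
  with AB show "mono_related p q"
    unfolding monotone_set_def by blast
qed

lemma monotone_set_extend_maximal:
  assumes "monotone_set M"
  obtains N where "maximal_monotone_set N" "M \<subseteq> N"
proof -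
  let ?S = "{N. monotone_set N \<and> M \<subseteq> N}"
  have "\<exists>N\<in>?S. \<forall>K\<in>?S. N \<subseteq> K \<longrightarrow> K = N"
  proof (rule subset_Zorn_nonempty)
    show "?S \<noteq> {}" using assms by blast
  next
    fix C assume C: "C \<noteq> {}" "subset.chain ?S C"
    then have "subset.chain (Collect monotone_set) C"
      by (auto simp: subset_chain_def)
    then have "monotone_set (\<Union>C)"
      by (rule monotone_set_Union_chain)
    \<comment> \<open>Nonemptiness of \<open>C\<close> is what puts \<open>M\<close> inside the
      union.\<close>
    moreover obtain A where "A \<in> C" "M \<subseteq> A"
      using C by (auto simp: subset_chain_def)
    ultimately show "\<Union>C \<in> ?S" by auto
  qed
  then obtain N where N: "monotone_set N" "M \<subseteq> N"
    and max: "\<And>K. monotone_set K \<Longrightarrow> M \<subseteq> K \<Longrightarrow> N \<subseteq> K \<Longrightarrow> K = N"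
    by auto
  \<comment> \<open>Maximality among the monotone supersets of \<open>M\<close> is maximality among
    all monotone sets, because whatever contains \<open>N\<close> contains \<open>M\<close>.\<close>
  have "K = N" if "monotone_set K" "N \<subseteq> K" for K
    using max[OF that(1) _ that(2)] N(2) that(2) by (metis order_trans)
  then have "maximal_monotone_set N"
    using N(1) by (auto simp: maximal_monotone_set_def)
  then show ?thesis
    using N(2) by (rule that)
qed

theorem lemma3p18:
  fixes M :: "('a::hadamard_space \<times> ('a \<times> 'a \<Rightarrow> real)) set"
  assumes "M \<subseteq> UNIV \<times> linear_dual"
  shows "monotone_set M \<longleftrightarrow>
    (\<exists>M'. maximal_monotone_set M' \<and> M' \<subseteq> monotone_polar M)"
proof
  assume "monotone_set M"
  then obtain N where "maximal_monotone_set N" "M \<subseteq> N"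
    by (rule monotone_set_extend_maximal)
  \<comment> \<open>The witness is \<open>N\<close>: it equals its own polar, and enlarging
    \<open>M\<close> to \<open>N\<close> shrinks the polar.\<close>
  then show "\<exists>M'. maximal_monotone_set M' \<and> M' \<subseteq> monotone_polar M"
    using maximal_monotone_set_polar monotone_polar_antimono by metis
next
  assume "\<exists>M'. maximal_monotone_set M' \<and> M' \<subseteq> monotone_polar M"
  then obtain N where N: "maximal_monotone_set N" "N \<subseteq> monotone_polar M"
    by blast
  \<comment> \<open>The inclusion is reversed to place \<open>M\<close> in the polar of
    \<open>N\<close>, which is \<open>N\<close> itself.\<close>
  then have "M \<subseteq> N"
    using subset_polar_sym[OF assms N(2)] maximal_monotone_set_polar[OF N(1)] by simp
  with N(1) show "monotone_set M"
    unfolding maximal_monotone_set_def by (metis monotone_set_subset)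
qed

end
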